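(* Let $k\ge 2$, $n\ge k$ and $t,p,q\ge 0$ be integers. Among all connected $n$-vertex graphs with clique number $k$, the kite graph $Ki(n,k)$ contains the least number of copies of $B_t(p,q)$; except when $k=2$, $t=0$, $p=q=1$, in which case the star $K_{1,n-1}$ contains the least number of copies of $B_0(1,1)=P_4$.
   Context: Graphs are finite and simple; "copies" means (not necessarily induced) subgraphs isomorphic to the given graph. For non-negative integers $t,p,q$, $B_t(p,q)$ is obtained from an edge $uv$ by adding $t$ vertices each joined to both $u$ and $v$, $p$ vertices joined only to $u$ and $q$ vertices joined only to $v$. $P_\ell$ is the path on $\ell$ vertices. The kite graph $Ki(n,k)$ consists of a clique $K_k$ together with a path on $n-k$ new vertices one of whose endpoints is joined to a vertex of the clique (for $n=k$ it is $K_k$). *)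

theory Defs
  imports "Graph_Theory.Graph_Theory"
begin

text \<open>
  A finite simple graph is a \<^locale>\<open>pair_graph\<close>: finite, symmetric, loop-free and without parallel
  arcs, so that each undirected edge is represented by its two opposite arcs.
\<close>

definition undirected :: "'a set \<Rightarrow> 'a rel \<Rightarrow> 'a pair_pre_digraph" where
  "undirected V E = \<lparr> pverts = V, parcs = E \<union> E\<inverse> \<rparr>"

text \<open>A subgraph isomorphic to a symmetric digraph is symmetric, so every element of the set
  below is itself an undirected graph. Copies are counted unlabelled (not as embeddings).\<close>

definition num_copies :: "'b pair_pre_digraph \<Rightarrow> 'a pair_pre_digraph \<Rightarrow> nat" where
  "num_copies B G =
     card {H :: 'a pair_pre_digraph.
             subgraph (with_proj H) (with_proj G) \<and> digraph_iso (with_proj B) (with_proj H)}"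

definition clique_number :: "'a pair_pre_digraph \<Rightarrow> nat" where
  "clique_number G =
     Max {m. \<exists>H :: 'a pair_pre_digraph.
               subgraph (with_proj H) (with_proj G) \<and> complete_digraph m (with_proj H)}"

text \<open>The name \<open>connected\<close> is qualified to distinguish it from the topological notion.\<close>

definition connected_graphs :: "nat \<Rightarrow> nat \<Rightarrow> 'a pair_pre_digraph set" where
  "connected_graphs n k =
     {G. pair_graph G \<and> Digraph_Component.connected (with_proj G) \<and>
         card (pverts G) = n \<and> clique_number G = k}"

text \<open>Vertices of \<open>B\<^sub>t(p,q)\<close>: the ends \<open>u\<close>, \<open>v\<close> of the base edge, their added common neighbours,
  and the vertices joined to only one of them.\<close>

datatype book_vertex = End_u | End_v | Common nat | Only_u nat | Only_v nat

definition book_graph :: "nat \<Rightarrow> nat \<Rightarrow> nat \<Rightarrow> book_vertex pair_pre_digraph" where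
  "book_graph t p q =
     undirected
       ({End_u, End_v} \<union> Common ` {..<t} \<union> Only_u ` {..<p} \<union> Only_v ` {..<q})
       ({(End_u, End_v)} \<union> {End_u, End_v} \<times> Common ` {..<t}
          \<union> {End_u} \<times> Only_u ` {..<p} \<union> {End_v} \<times> Only_v ` {..<q})"

definition path_graph :: "nat \<Rightarrow> nat pair_pre_digraph" where
  "path_graph l = undirected {..<l} {(i, Suc i) | i. Suc i < l}"

text \<open>For \<open>1 \<le> k \<le> n\<close> the clique is on \<open>{..<k}\<close>, the new path is \<open>k, \<dots>, n - 1\<close>, and it is attached
  through the edge between \<open>k - 1\<close> and \<open>k\<close>.\<close>

definition kite_graph :: "nat \<Rightarrow> nat \<Rightarrow> nat pair_pre_digraph" where
  "kite_graph n k =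
     undirected {..<n}
       ({(i, j). i < j \<and> j < k} \<union> {(i, Suc i) | i. k \<le> Suc i \<and> Suc i < n})"

text \<open>The star \<open>K\<^bsub>1,n-1\<^esub>\<close>, for \<open>n \<ge> 1\<close>.\<close>

definition star_graph :: "nat \<Rightarrow> nat pair_pre_digraph" where
  "star_graph n = undirected {..<n} ({0} \<times> {1..<n})"

end

theory Submission
  imports Defs
begin

text \<open>
  Let \<open>K\<close> be a \<open>k\<close>-clique of the connected graph \<open>G\<close>. By connectedness, \<open>G\<close> can be built up
  from \<open>K\<close> by adding one vertex at a time, each adjacent to a vertex that is already present, and the kite
  arises in the same way by walking along its path. So it suffices to compare, step by step, the
  copies through the added vertex. The first step yields \<open>Ki(k + 1, k)\<close> inside \<open>G\<close>, and in the kite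
  the later vertices lie in no copy at all unless \<open>t = 0\<close> and, up to symmetry, \<open>p = q = 0\<close> (an edge),
  \<open>(p, q) = (0, 1)\<close> (the path \<open>P\<^sub>3\<close>), or \<open>p = 1\<close> and \<open>q \<ge> 1\<close>. In the first two cases each further
  vertex of the kite lies in one copy, and each one added in \<open>G\<close> lies in at least one. In the last
  case the second path vertex lies in \<open>k - 1\<close> choose \<open>q\<close> copies, and wherever the second vertex of
  \<open>G\<close> is attached one finds at least as many, unless \<open>k = 2\<close> and \<open>q = 1\<close>, when the second vertex
  may turn \<open>G\<close> into a star, which contains no \<open>P\<^sub>4\<close>; later vertices lie in one copy if \<open>q = 1\<close>, in none if
  \<open>q \<ge> 2\<close>.
\<close>

section \<open>Pair digraphs\<close>

text \<open>An arc of a pair digraph is the pair of its ends, so the arc map of an isomorphism is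
  forced to be \<open>map_prod f f\<close> and a vertex map alone describes it.\<close>

lemma digraph_iso_with_proj_iff:
  "digraph_iso (with_proj G) (with_proj H) \<longleftrightarrow>
     pair_wf_digraph G \<and> (\<exists>f. inj_on f (pverts G) \<and> pverts H = f ` pverts G \<and>
       parcs H = map_prod f f ` parcs G)" (is "?L \<longleftrightarrow> ?R")
proof
  assume ?L
  then obtain h where h: "pre_digraph.digraph_isomorphism (with_proj G) h"
      "with_proj H = app_iso h (with_proj G)"
    unfolding digraph_iso_def by blast
  let ?f = "iso_verts h"
  have wf: "pair_wf_digraph G" and inj: "inj_on ?f (pverts G)"
    and ends: "\<And>a. a \<in> parcs G \<Longrightarrow> ?f (fst a) = iso_tail h (iso_arcs h a) \<and>
           ?f (snd a) = iso_head h (iso_arcs h a)"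
    using h(1) unfolding pre_digraph.digraph_isomorphism_def by (auto simp: wf_digraph_wp_iff)
  have "pverts H = ?f ` pverts G" "parcs H = iso_arcs h ` parcs G"
      "iso_tail h = fst" "iso_head h = snd"
    using h(2) by (simp_all add: with_proj_def app_iso_def)
  moreover from this ends have "iso_arcs h a = map_prod ?f ?f a" if "a \<in> parcs G" for a
    using that by (simp add: prod_eq_iff)
  ultimately show ?R using wf inj by (metis image_cong)
next
  assume ?R
  then obtain f where wf: "pair_wf_digraph G" and inj: "inj_on f (pverts G)"
    and H: "pverts H = f ` pverts G" "parcs H = map_prod f f ` parcs G" by blast
  interpret pair_wf_digraph G by (fact wf)
  let ?h = "\<lparr>iso_verts = f, iso_arcs = map_prod f f, iso_head = snd, iso_tail = fst\<rparr>"
  have "inj_on (map_prod f f) (parcs G)"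
    by (rule inj_on_subset[OF map_prod_inj_on[OF inj inj]])
       (use arc_fst_in_verts arc_snd_in_verts in force)
  then have "digraph_isomorphism ?h"
    unfolding digraph_isomorphism_def using inj wf_digraph_axioms by auto
  moreover have "with_proj H = app_iso ?h (with_proj G)"
    using H by (simp add: with_proj_def app_iso_def)
  ultimately show ?L unfolding digraph_iso_def by blast
qed

lemma pverts_undirected [simp]: "pverts (undirected V E) = V"
  and parcs_undirected [simp]: "parcs (undirected V E) = E \<union> E\<inverse>"
  by (simp_all add: undirected_def)

lemma pair_graph_undirected:
  assumes "finite V" "E \<subseteq> V \<times> V" "\<And>x. (x, x) \<notin> E"
  shows "pair_graph (undirected V E)"
proof -
  have "finite (E \<union> E\<inverse>)"
    using assms(1,2) finite_subset by blast
  moreover have "sym (E \<union> E\<inverse>)" by (simp add: sym_Un_converse)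
  ultimately show ?thesis
    using assms by unfold_locales (auto simp: symmetric_def)
qed

lemma (in pair_graph) sym_parcs: "sym (parcs G)"
  using arcs_symmetric by (auto intro: symI)

text \<open>Symmetry reverses paths, so any two vertices are joined through
  \<open>r\<close>.\<close>

lemma (in pair_graph) connectedI_root:
  assumes "r \<in> pverts G" "\<And>v. v \<in> pverts G \<Longrightarrow> r \<rightarrow>\<^sup>*\<^bsub>with_proj G\<^esub> v"
  shows "Digraph_Component.connected (with_proj G)"
  unfolding connected_def
proof (rule strongly_connectedI)
  show "verts (with_proj (mk_symmetric (with_proj G))) \<noteq> {}" using assms(1) by auto
next
  fix u v assume "u \<in> verts (with_proj (mk_symmetric (with_proj G)))"
    "v \<in> verts (with_proj (mk_symmetric (with_proj G)))"
  then have "u \<rightarrow>\<^sup>*\<^bsub>with_proj G\<^esub> r" "r \<rightarrow>\<^sup>*\<^bsub>with_proj G\<^esub> v"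
    using assms symmetric_reachable' by auto
  then have "u \<rightarrow>\<^sup>*\<^bsub>with_proj G\<^esub> v" by (rule reachable_trans)
  then show "u \<rightarrow>\<^sup>*\<^bsub>with_proj (mk_symmetric (with_proj G))\<^esub> v"
    by (rule reachable_mk_symmetricI)
qed

text \<open>If no arc left \<open>W\<close>, reachability from a vertex of \<open>W\<close> would
  never leave \<open>W\<close>. It is in this form that connectedness drives the growth of a graph
  vertex by vertex.\<close>

lemma (in pair_graph) connected_boundary:
  assumes "Digraph_Component.connected (with_proj G)" "W \<subset> pverts G" "W \<noteq> {}"
  shows "\<exists>z\<in>W. \<exists>y\<in>pverts G - W. (z, y) \<in> parcs G"
proof (rule ccontr)
  assume none: "\<not> ?thesis"
  obtain u v where "u \<in> W" "v \<in> pverts G" "v \<notin> W" using assms(2,3) by blast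
  then have "u \<rightarrow>\<^sup>*\<^bsub>with_proj (mk_symmetric (with_proj G))\<^esub> v"
    using assms(1,2) unfolding connected_def strongly_connected_def by auto
  then have "u \<rightarrow>\<^sup>*\<^bsub>with_proj G\<^esub> v"
    by (subst (asm) reachable_mk_symmetric_eq) (simp_all add: sym_arcs)
  then have "v \<in> W"
  proof (induction rule: reachable_induct)
    case base then show ?case using \<open>u \<in> W\<close> by simp
  next
    case (step x y)
    then show ?case using none adj_in_verts[of x y] by auto
  qed
  with \<open>v \<notin> W\<close> show False by simp
qed

section \<open>Cliques as vertex sets\<close>

definition cliques :: "'a set \<Rightarrow> 'a rel \<Rightarrow> 'a set set" where
  "cliques V E = {S. S \<subseteq> V \<and> (\<forall>x\<in>S. \<forall>y\<in>S. x \<noteq> y \<longrightarrow> (x, y) \<in> E)}"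

text \<open>A complete subgraph is determined by its vertex set, so the maximum may range over sets
  instead of subgraphs.\<close>

lemma (in pair_graph) clique_number_conv:
  "clique_number G = Max (card ` cliques (pverts G) (parcs G))"
proof -
  have "(\<exists>H. subgraph (with_proj H) (with_proj G) \<and> complete_digraph m (with_proj H)) \<longleftrightarrow>
      m \<in> card ` cliques (pverts G) (parcs G)" for m
  proof
    assume "\<exists>H. subgraph (with_proj H) (with_proj G) \<and> complete_digraph m (with_proj H)"
    then obtain H where H: "subgraph (with_proj H) (with_proj G)"
        "complete_digraph m (with_proj H)" by blast
    then have "pverts H \<in> cliques (pverts G) (parcs G)" "card (pverts H) = m"
      unfolding cliques_def subgraph_def complete_digraph_pair_def by auto
    then show "m \<in> card ` cliques (pverts G) (parcs G)" by blast
  next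
    assume "m \<in> card ` cliques (pverts G) (parcs G)"
    then obtain S where S: "S \<subseteq> pverts G" "\<forall>x\<in>S. \<forall>y\<in>S. x \<noteq> y \<longrightarrow> (x, y) \<in> parcs G"
      "card S = m" unfolding cliques_def by blast
    let ?H = "\<lparr>pverts = S, parcs = {(x, y). (x, y) \<in> S \<times> S \<and> x \<noteq> y}\<rparr>"
    have "finite S" using S(1) finite_subset[OF _ pair_finite_verts] by blast
    then have K: "complete_digraph m (with_proj ?H)"
      using S by (simp add: complete_digraph_pair_def)
    have "wf_digraph (with_proj ?H)" unfolding wf_digraph_wp_iff by unfold_locales auto
    then have "subgraph (with_proj ?H) (with_proj G)"
      unfolding subgraph_def using S wf_digraph_axioms by auto
    then show "\<exists>H. subgraph (with_proj H) (with_proj G) \<and> complete_digraph m (with_proj H)"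
      using K by blast
  qed
  then show ?thesis unfolding clique_number_def by simp
qed

lemma (in pair_graph) finite_cliques: "finite (cliques (pverts G) (parcs G))"
  using pair_finite_verts by (simp add: cliques_def)

lemma (in pair_graph) obtain_max_clique:
  obtains K where "K \<in> cliques (pverts G) (parcs G)" "card K = clique_number G"
proof -
  have "{} \<in> cliques (pverts G) (parcs G)" by (simp add: cliques_def)
  then have "clique_number G \<in> card ` cliques (pverts G) (parcs G)"
    unfolding clique_number_conv by (intro Max_in) (auto simp: finite_cliques)
  then show ?thesis using that by auto
qed

lemma (in pair_graph) clique_number_eqI:
  assumes "K \<in> cliques (pverts G) (parcs G)" "card K = k"
    "\<And>S. S \<in> cliques (pverts G) (parcs G) \<Longrightarrow> card S \<le> k"
  shows "clique_number G = k"
  unfolding clique_number_conv using assms finite_cliques by (intro Max_eqI) auto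

section \<open>Books\<close>

definition book :: "'a \<Rightarrow> 'a \<Rightarrow> 'a set \<Rightarrow> 'a set \<Rightarrow> 'a set \<Rightarrow> 'a pair_pre_digraph" where
  "book u v C P Q =
     undirected ({u, v} \<union> C \<union> P \<union> Q) ({(u, v)} \<union> {u, v} \<times> C \<union> {u} \<times> P \<union> {v} \<times> Q)"

text \<open>\<open>V\<close> and \<open>E\<close> are separate so that the vertex set can grow while
  \<open>E\<close> stays the arc set of the whole graph; the books are then those of the subgraph
  induced on \<open>V\<close>. Only one orientation of each edge is required in \<open>E\<close>;
  the other comes from symmetry.\<close>

definition is_book ::
  "nat \<Rightarrow> nat \<Rightarrow> nat \<Rightarrow> 'a set \<Rightarrow> 'a rel \<Rightarrow> 'a \<Rightarrow> 'a \<Rightarrow> 'a set \<Rightarrow> 'a set \<Rightarrow> 'a set \<Rightarrow> bool" where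
  "is_book t p q V E u v C P Q \<longleftrightarrow>
     {u, v} \<union> C \<union> P \<union> Q \<subseteq> V \<and> {(u, v)} \<union> {u, v} \<times> C \<union> {u} \<times> P \<union> {v} \<times> Q \<subseteq> E \<and>
     u \<noteq> v \<and> u \<notin> C \<union> P \<union> Q \<and> v \<notin> C \<union> P \<union> Q \<and>
     C \<inter> P = {} \<and> C \<inter> Q = {} \<and> P \<inter> Q = {} \<and>
     finite C \<and> finite P \<and> finite Q \<and> card C = t \<and> card P = p \<and> card Q = q"

text \<open>A set of graphs rather than of tuples: a copy arising from several choices of
  \<open>u\<close>, \<open>v\<close>, \<open>C\<close>, \<open>P\<close>, \<open>Q\<close> is
  counted once.\<close>

definition books :: "nat \<Rightarrow> nat \<Rightarrow> nat \<Rightarrow> 'a set \<Rightarrow> 'a rel \<Rightarrow> 'a pair_pre_digraph set" where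
  "books t p q V E = {book u v C P Q | u v C P Q. is_book t p q V E u v C P Q}"

lemma pverts_book [simp]: "pverts (book u v C P Q) = {u, v} \<union> C \<union> P \<union> Q"
  by (simp add: book_def)

lemma map_prod_image_Times: "map_prod f f ` (A \<times> B) = (f ` A) \<times> (f ` B)"
  by auto

lemma map_prod_image_converse: "map_prod f f ` (A\<inverse>) = (map_prod f f ` A)\<inverse>"
  by (auto intro!: rev_image_eqI)

lemmas image_arcs_simps = image_Un image_image map_prod_image_Times map_prod_image_converse

lemma pair_graph_book_graph: "pair_graph (book_graph t p q)"
  unfolding book_graph_def by (rule pair_graph_undirected) auto

lemma mem_book_graph:
  "End_u \<in> pverts (book_graph t p q)" "End_v \<in> pverts (book_graph t p q)"
  "Common i \<in> pverts (book_graph t p q) \<longleftrightarrow> i < t"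
  "Only_u i \<in> pverts (book_graph t p q) \<longleftrightarrow> i < p"
  "Only_v i \<in> pverts (book_graph t p q) \<longleftrightarrow> i < q"
  by (auto simp: book_graph_def)

text \<open>An injection of \<open>book_graph t p q\<close> yields the ends and the sets
  \<open>C\<close>, \<open>P\<close>, \<open>Q\<close> as images of the vertex classes; conversely,
  enumerations of \<open>C\<close>, \<open>P\<close> and \<open>Q\<close> glue to such an
  injection.\<close>

lemma num_copies_book_graph:
  assumes "pair_graph G"
  shows "num_copies (book_graph t p q) G = card (books t p q (pverts G) (parcs G))"
proof -
  interpret pair_graph G by (fact assms)
  interpret B: pair_graph "book_graph t p q" by (rule pair_graph_book_graph)
  have "subgraph (with_proj H) (with_proj G) \<and> digraph_iso (with_proj (book_graph t p q)) (with_proj H)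
      \<longleftrightarrow> H \<in> books t p q (pverts G) (parcs G)" (is "?L \<longleftrightarrow> ?R") for H
  proof
    assume ?L
    then obtain f where f: "inj_on f (pverts (book_graph t p q))"
      and H: "pverts H = f ` pverts (book_graph t p q)"
        "parcs H = map_prod f f ` parcs (book_graph t p q)"
      and sub: "pverts H \<subseteq> pverts G" "parcs H \<subseteq> parcs G"
      unfolding digraph_iso_with_proj_iff subgraph_def by auto
    let ?u = "f End_u" and ?v = "f End_v" and ?C = "(f \<circ> Common) ` {..<t}"
      and ?P = "(f \<circ> Only_u) ` {..<p}" and ?Q = "(f \<circ> Only_v) ` {..<q}"
    have HB: "H = book ?u ?v ?C ?P ?Q"
      by (rule pair_pre_digraph.equality) (simp_all add: H book_def book_graph_def image_arcs_simps)
    note f_eq = inj_on_eq_iff[OF f]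
    have inj: "inj_on (f \<circ> Common) {..<t}" "inj_on (f \<circ> Only_u) {..<p}"
        "inj_on (f \<circ> Only_v) {..<q}"
      by (auto simp: f_eq mem_book_graph intro!: inj_onI)
    have "is_book t p q (pverts G) (parcs G) ?u ?v ?C ?P ?Q"
      unfolding is_book_def
    proof (intro conjI)
      show "{?u, ?v} \<union> ?C \<union> ?P \<union> ?Q \<subseteq> pverts G"
        using sub(1) unfolding HB by simp
      show "{(?u, ?v)} \<union> {?u, ?v} \<times> ?C \<union> {?u} \<times> ?P \<union> {?v} \<times> ?Q \<subseteq> parcs G"
        using sub(2) unfolding HB book_def by simp
    qed (auto simp: card_image inj[unfolded comp_def] f_eq mem_book_graph)
    then show ?R unfolding books_def HB by blast
  next
    assume ?R
    then obtain u v C P Q where H: "H = book u v C P Q"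
      and b: "is_book t p q (pverts G) (parcs G) u v C P Q"
      unfolding books_def by blast
    obtain c where c: "bij_betw c {..<t} C"
      using b ex_bij_betw_nat_finite[of C] unfolding is_book_def lessThan_atLeast0 by auto
    obtain d where d: "bij_betw d {..<p} P"
      using b ex_bij_betw_nat_finite[of P] unfolding is_book_def lessThan_atLeast0 by auto
    obtain e where e: "bij_betw e {..<q} Q"
      using b ex_bij_betw_nat_finite[of Q] unfolding is_book_def lessThan_atLeast0 by auto
    define f where "f = case_book_vertex u v c d e"
    have img: "c ` {..<t} = C" "d ` {..<p} = P" "e ` {..<q} = Q"
      using c d e by (auto simp: bij_betw_def)
    have mem: "\<And>i. i < t \<Longrightarrow> c i \<in> C" "\<And>i. i < p \<Longrightarrow> d i \<in> P" "\<And>i. i < q \<Longrightarrow> e i \<in> Q"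
      using img by auto
    have distinct: "u \<noteq> v" "\<And>i. i < t \<Longrightarrow> u \<noteq> c i" "\<And>i. i < t \<Longrightarrow> v \<noteq> c i"
        "\<And>i. i < p \<Longrightarrow> u \<noteq> d i" "\<And>i. i < p \<Longrightarrow> v \<noteq> d i"
        "\<And>i. i < q \<Longrightarrow> u \<noteq> e i" "\<And>i. i < q \<Longrightarrow> v \<noteq> e i"
        "\<And>i j. i < t \<Longrightarrow> j < p \<Longrightarrow> c i \<noteq> d j" "\<And>i j. i < t \<Longrightarrow> j < q \<Longrightarrow> c i \<noteq> e j"
        "\<And>i j. i < p \<Longrightarrow> j < q \<Longrightarrow> d i \<noteq> e j"
      using b mem unfolding is_book_def by (blast, blast, blast, blast, blast, blast, blast,
          (metis IntI empty_iff)+)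
    have same: "\<And>i j. i < t \<Longrightarrow> j < t \<Longrightarrow> c i = c j \<longleftrightarrow> i = j"
        "\<And>i j. i < p \<Longrightarrow> j < p \<Longrightarrow> d i = d j \<longleftrightarrow> i = j"
        "\<And>i j. i < q \<Longrightarrow> j < q \<Longrightarrow> e i = e j \<longleftrightarrow> i = j"
      using c d e by (auto simp: bij_betw_def inj_on_eq_iff)
    have "inj_on f (pverts (book_graph t p q))"
    proof (rule inj_onI)
      fix x y assume "x \<in> pverts (book_graph t p q)" "y \<in> pverts (book_graph t p q)" "f x = f y"
      then show "x = y"
        by (cases x; cases y) (simp_all add: f_def mem_book_graph same distinct distinct[THEN not_sym])
    qed
    moreover have "pverts H = f ` pverts (book_graph t p q)"
      unfolding H book_def book_graph_def by (simp add: image_arcs_simps f_def img)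
    moreover have "parcs H = map_prod f f ` parcs (book_graph t p q)"
      unfolding H book_def book_graph_def by (simp add: image_arcs_simps f_def img)
    ultimately have iso: "digraph_iso (with_proj (book_graph t p q)) (with_proj H)"
      unfolding digraph_iso_with_proj_iff using B.pair_wf_digraph by blast
    \<comment> \<open>The reverse arcs of the book, absent from \<open>is_book\<close>, lie in
      \<open>G\<close> because \<open>G\<close> is symmetric.\<close>
    have "pverts H \<subseteq> pverts G" "parcs H \<subseteq> parcs G"
      using b arcs_symmetric unfolding H book_def is_book_def by (auto 0 3)
    moreover have "wf_digraph (with_proj H)"
      unfolding wf_digraph_wp_iff H book_def by unfold_locales auto
    ultimately show ?L using iso wf_digraph_axioms unfolding subgraph_def by auto
  qed
  then show ?thesis unfolding num_copies_def by simp
qed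

section \<open>Counting books: restriction, symmetry and embedding\<close>

lemma is_book_mono:
  "W \<subseteq> V \<Longrightarrow> is_book t p q W E u v C P Q \<Longrightarrow> is_book t p q V E u v C P Q"
  by (auto simp: is_book_def)

lemma is_book_subset:
  "is_book t p q V E u v C P Q \<Longrightarrow> W \<subseteq> V \<Longrightarrow> pverts (book u v C P Q) \<subseteq> W \<Longrightarrow>
     is_book t p q W E u v C P Q"
  by (auto simp: is_book_def)

lemma books_subset:
  assumes "H \<in> books t p q V E"
  shows "pverts H \<subseteq> V" "parcs H \<subseteq> V \<times> V"
  using assms by (auto simp: books_def book_def is_book_def)

lemma books_mono: "W \<subseteq> V \<Longrightarrow> books t p q W E \<subseteq> books t p q V E"
  using is_book_mono[of W V] unfolding books_def by blast

lemma books_restrict: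
  assumes "H \<in> books t p q V E" "W \<subseteq> V" "pverts H \<subseteq> W"
  shows "H \<in> books t p q W E"
proof -
  obtain u v C P Q where H: "H = book u v C P Q" and b: "is_book t p q V E u v C P Q"
    using assms(1) unfolding books_def by blast
  have "is_book t p q W E u v C P Q"
    using is_book_subset[OF b assms(2)] assms(3) unfolding H by blast
  then show ?thesis unfolding books_def H by blast
qed

lemma finite_books:
  assumes "finite V"
  shows "finite (books t p q V E)"
proof (rule finite_subset)
  show "books t p q V E \<subseteq> (\<lambda>(A, B). \<lparr>pverts = A, parcs = B\<rparr>) ` (Pow V \<times> Pow (V \<times> V))"
  proof
    fix H assume "H \<in> books t p q V E"
    then have "(pverts H, parcs H) \<in> Pow V \<times> Pow (V \<times> V)"
      using books_subset by blast
    then show "H \<in> (\<lambda>(A, B). \<lparr>pverts = A, parcs = B\<rparr>) ` (Pow V \<times> Pow (V \<times> V))"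
      by (rule rev_image_eqI) simp
  qed
qed (use assms in simp)

lemma book_swap: "book v u C Q P = book u v C P Q"
  by (rule pair_pre_digraph.equality) (auto simp: book_def)

text \<open>Exchanging the two ends exchanges \<open>p\<close> and \<open>q\<close>, which later
  allows \<open>p \<le> q\<close> to be assumed.\<close>

lemma books_swap:
  assumes "sym E"
  shows "books t p q V E = books t q p V E"
proof -
  have "books t p q V E \<subseteq> books t q p V E" for p q
  proof
    fix H assume "H \<in> books t p q V E"
    then obtain u v C P Q where H: "H = book u v C P Q" and b: "is_book t p q V E u v C P Q"
      unfolding books_def by blast
    have "(v, u) \<in> E" using assms b by (auto simp: is_book_def dest: symD)
    then have "is_book t q p V E v u C Q P" using b unfolding is_book_def by blast
    moreover have "H = book v u C Q P" unfolding H by (rule book_swap)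
    ultimately show "H \<in> books t q p V E" unfolding books_def by blast
  qed
  then show ?thesis by blast
qed

definition books_at :: "nat \<Rightarrow> nat \<Rightarrow> nat \<Rightarrow> 'a set \<Rightarrow> 'a rel \<Rightarrow> 'a \<Rightarrow> 'a pair_pre_digraph set" where
  "books_at t p q V E x = {H \<in> books t p q V E. x \<in> pverts H}"

lemma finite_books_at: "finite V \<Longrightarrow> finite (books_at t p q V E x)"
  by (simp add: books_at_def finite_books)

lemma books_atI:
  "is_book t p q V E u v C P Q \<Longrightarrow> x \<in> {u, v} \<union> C \<union> P \<union> Q \<Longrightarrow>
     book u v C P Q \<in> books_at t p q V E x"
  unfolding books_at_def books_def by fastforce

lemma books_atE:
  assumes "H \<in> books_at t p q V E x"
  obtains u v C P Q where "H = book u v C P Q" "is_book t p q V E u v C P Q"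
    "x \<in> {u, v} \<union> C \<union> P \<union> Q"
  using assms by (auto simp: books_at_def books_def)

text \<open>A copy avoiding \<open>x\<close> already lies in \<open>W\<close>, so adding
  \<open>x\<close> creates exactly the copies through \<open>x\<close>.\<close>

lemma card_books_insert:
  assumes "finite W" "x \<notin> W"
  shows "card (books t p q (insert x W) E) =
    card (books t p q W E) + card (books_at t p q (insert x W) E x)"
proof -
  have "books t p q (insert x W) E = books t p q W E \<union> books_at t p q (insert x W) E x"
    (is "?L = ?R")
  proof (intro set_eqI iffI)
    fix H assume H: "H \<in> ?L"
    show "H \<in> ?R"
    proof (cases "x \<in> pverts H")
      case False
      with H books_subset(1)[OF H] have "H \<in> books t p q W E"
        by (intro books_restrict[OF H]) auto
      then show ?thesis ..
    qed (simp add: H books_at_def)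
  next
    fix H assume "H \<in> ?R"
    then show "H \<in> ?L" using books_mono[of W "insert x W" t p q E] by (auto simp: books_at_def)
  qed
  moreover have "books t p q W E \<inter> books_at t p q (insert x W) E x = {}"
    using books_subset(1)[of _ t p q W E] assms(2) by (auto simp: books_at_def)
  ultimately show ?thesis
    using assms(1) by (simp add: card_Un_disjoint finite_books finite_books_at)
qed

text \<open>An injective \<open>f\<close> is injective on pairs of vertices too, so distinct copies
  have distinct images. Arcs are only preserved, not reflected, which suffices because copies need
  not be induced.\<close>

lemma card_books_le_inj:
  assumes "finite V'" "inj_on f V" "f ` V \<subseteq> V'"
    and arcs: "\<And>a b. a \<in> V \<Longrightarrow> b \<in> V \<Longrightarrow> a \<noteq> b \<Longrightarrow> (a, b) \<in> E \<Longrightarrow> (f a, f b) \<in> E'"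
  shows "card (books t p q V E) \<le> card (books t p q V' E')"
proof (rule card_inj_on_le)
  let ?F = "\<lambda>H. \<lparr>pverts = f ` pverts H, parcs = map_prod f f ` parcs H\<rparr>"
  show "finite (books t p q V' E')" using assms(1) by (rule finite_books)
  show "inj_on ?F (books t p q V E)"
  proof (rule inj_onI)
    fix H H' assume H: "H \<in> books t p q V E" "H' \<in> books t p q V E" and eq: "?F H = ?F H'"
    have "pverts H = pverts H'"
      using inj_on_image_eq_iff[OF assms(2)] books_subset(1)[OF H(1)] books_subset(1)[OF H(2)] eq
      by simp
    moreover have "parcs H = parcs H'"
      using inj_on_image_eq_iff[OF map_prod_inj_on[OF assms(2,2)]]
        books_subset(2)[OF H(1)] books_subset(2)[OF H(2)] eq
      by simp
    ultimately show "H = H'" by (intro pair_pre_digraph.equality) auto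
  qed
  show "?F ` books t p q V E \<subseteq> books t p q V' E'"
  proof
    fix H' assume "H' \<in> ?F ` books t p q V E"
    then obtain u v C P Q where H': "H' = ?F (book u v C P Q)" and b: "is_book t p q V E u v C P Q"
      unfolding books_def by blast
    have "H' = book (f u) (f v) (f ` C) (f ` P) (f ` Q)"
      unfolding H' by (rule pair_pre_digraph.equality) (simp_all add: book_def image_arcs_simps)
    moreover have "is_book t p q V' E' (f u) (f v) (f ` C) (f ` P) (f ` Q)"
      unfolding is_book_def
    proof (intro conjI)
      note sub = inj_on_subset[OF assms(2)] and f_eq = inj_on_eq_iff[OF assms(2)]
      have V: "u \<in> V" "v \<in> V" "C \<subseteq> V" "P \<subseteq> V" "Q \<subseteq> V" using b by (auto simp: is_book_def)
      note im = inj_on_image_Int[OF assms(2), symmetric]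
      show "{f u, f v} \<union> f ` C \<union> f ` P \<union> f ` Q \<subseteq> V'" using V assms(3) by blast
      show "{(f u, f v)} \<union> {f u, f v} \<times> f ` C \<union> {f u} \<times> f ` P \<union> {f v} \<times> f ` Q \<subseteq> E'"
        using b V unfolding is_book_def by (auto intro!: arcs)
      show "f u \<noteq> f v" using b V f_eq by (simp add: is_book_def)
      show "f u \<notin> f ` C \<union> f ` P \<union> f ` Q" "f v \<notin> f ` C \<union> f ` P \<union> f ` Q"
        using b V inj_on_image_mem_iff[OF assms(2)] by (simp_all add: is_book_def)
      show "f ` C \<inter> f ` P = {}" "f ` C \<inter> f ` Q = {}" "f ` P \<inter> f ` Q = {}"
        using b V by (simp_all add: is_book_def im)
      show "finite (f ` C)" "finite (f ` P)" "finite (f ` Q)"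
        using b by (simp_all add: is_book_def)
      show "card (f ` C) = t" "card (f ` P) = p" "card (f ` Q) = q"
        using b V by (simp_all add: is_book_def card_image sub)
    qed
    ultimately show "H' \<in> books t p q V' E'" unfolding books_def by blast
  qed
qed

section \<open>Copies in the kite through its last vertex\<close>

lemma pverts_kite_graph [simp]: "pverts (kite_graph n k) = {..<n}"
  by (simp add: kite_graph_def)

text \<open>Clique arcs are separated from the arcs of the attached path; the edge joining
  \<open>k - 1\<close> to \<open>k\<close> counts among the latter.\<close>

lemma kite_arc_iff:
  assumes "k \<le> n"
  shows "(i, j) \<in> parcs (kite_graph n k) \<longleftrightarrow> i < n \<and> j < n \<and>
    (i \<noteq> j \<and> i < k \<and> j < k \<or> j = Suc i \<and> k \<le> j \<or> i = Suc j \<and> k \<le> i)"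
  using assms by (auto simp: kite_graph_def)

lemma sym_kite: "sym (parcs (kite_graph n k))"
  by (simp add: kite_graph_def sym_Un_converse)

text \<open>A vertex of the attached path has no neighbours but its predecessor and its successor.
  Hence an end of a book with three neighbours must lie in the clique.\<close>

lemma kite_degree_le_2:
  assumes "k \<le> n" "k \<le> v" "\<And>w. w \<in> A \<Longrightarrow> (v, w) \<in> parcs (kite_graph n k)"
  shows "card A \<le> 2"
proof -
  have "A \<subseteq> {v - 1, Suc v}" using assms(1,2) by (auto dest!: assms(3) simp: kite_arc_iff)
  then have "card A \<le> card {v - 1, Suc v}" by (intro card_mono) auto
  also have "\<dots> \<le> 2" by (simp add: card_insert_if)
  finally show ?thesis .
qed

text \<open>The vertex \<open>m\<close> is at distance at least two from the clique. With a common
  neighbour the base edge lies in a triangle, hence in the clique, and every vertex of the book is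
  adjacent to an end of it. Otherwise an end with two or more leaves has degree at least three and
  lies in the clique, and an end without leaves is adjacent to such an end. Either way the book does
  not reach \<open>m\<close>.\<close>

lemma kite_new_local:
  assumes "k \<le> n" "k < m" "1 \<le> t \<or> 2 \<le> p \<and> 2 \<le> q \<or> p = 0 \<and> 2 \<le> q"
  shows "books_at t p q {..<Suc m} (parcs (kite_graph n k)) m = {}"
proof (rule equals0I)
  fix H assume "H \<in> books_at t p q {..<Suc m} (parcs (kite_graph n k)) m"
  then obtain u v C P Q where
    b: "is_book t p q {..<Suc m} (parcs (kite_graph n k)) u v C P Q"
    and m: "m \<in> {u, v} \<union> C \<union> P \<union> Q"
    by (rule books_atE)
  note bd = b[unfolded is_book_def]
  have uv: "(u, v) \<in> parcs (kite_graph n k)" "(v, u) \<in> parcs (kite_graph n k)"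
    and uC: "\<And>c. c \<in> C \<Longrightarrow> (u, c) \<in> parcs (kite_graph n k)"
    and vC: "\<And>c. c \<in> C \<Longrightarrow> (v, c) \<in> parcs (kite_graph n k)"
    and uP: "\<And>c. c \<in> P \<Longrightarrow> (u, c) \<in> parcs (kite_graph n k)"
    and vQ: "\<And>c. c \<in> Q \<Longrightarrow> (v, c) \<in> parcs (kite_graph n k)"
    using bd sym_kite[of n k] by (auto dest: symD)
  show False
  proof (cases "1 \<le> t")
    case True
    then obtain c where c: "c \<in> C" using bd by fastforce
    have lt: "u < Suc m" "v < Suc m" "c < Suc m" using bd c by auto
    have ne: "u \<noteq> v" "u \<noteq> c" "v \<noteq> c" using bd c by auto
    consider "m \<in> {u, v}" | "m \<in> C" | "m \<in> P" "m \<noteq> u" "m \<noteq> v" "m \<noteq> c"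
      | "m \<in> Q" "m \<noteq> u" "m \<noteq> v" "m \<noteq> c" using m bd c by blast
    then show False
    proof cases
      case 1
      then show ?thesis using uv(1) uC[OF c] vC[OF c] lt ne assms(1,2) by (auto simp: kite_arc_iff)
    next
      case 2
      then show ?thesis using uC[of m] vC[of m] lt ne assms(1,2) by (auto simp: kite_arc_iff)
    next
      case 3
      then show ?thesis using uv(1) uC[OF c] uP[of m] lt ne assms(1,2) by (auto simp: kite_arc_iff)
    next
      case 4
      then show ?thesis using uv(1) vC[OF c] vQ[of m] lt ne assms(1,2) by (auto simp: kite_arc_iff)
    qed
  next
    case False
    then have "card C = 0" "2 \<le> q" "2 \<le> p \<or> card P = 0" using assms(3) bd by auto
    then have "C = {}" and q2: "2 \<le> q" and p: "2 \<le> p \<or> P = {}" using bd by (meson card_0_eq)+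
    \<comment> \<open>Each end is also a neighbour of the other, which raises the degrees to
      \<open>q + 1\<close> and \<open>p + 1\<close>.\<close>
    have "card (insert u Q) = Suc q" "card (insert v P) = Suc p" using bd by auto
    moreover have "k \<le> v \<Longrightarrow> card (insert u Q) \<le> 2" "k \<le> u \<Longrightarrow> card (insert v P) \<le> 2"
      using uv uP vQ by (auto intro!: kite_degree_le_2[OF assms(1)])
    ultimately have "v < k" "u < k \<or> P = {}" using q2 p by fastforce+
    then show False using m \<open>C = {}\<close> uv(1) uP[of m] vQ[of m] assms(1,2)
      by (auto simp: kite_arc_iff)
  qed
qed

section \<open>Kite vertices in books without common neighbours\<close>

lemma is_book_0D:
  assumes "is_book 0 p q V E u v C P Q" "sym E"
  shows "C = {}" "u \<in> V" "v \<in> V" "P \<subseteq> V" "Q \<subseteq> V" "u \<noteq> v" "u \<notin> P" "u \<notin> Q" "v \<notin> P" "v \<notin> Q"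
    "P \<inter> Q = {}" "finite P" "finite Q" "card P = p" "card Q = q"
    "(u, v) \<in> E" "(v, u) \<in> E" "\<And>w. w \<in> P \<Longrightarrow> (u, w) \<in> E" "\<And>w. w \<in> Q \<Longrightarrow> (v, w) \<in> E"
  using assms unfolding is_book_def by (auto dest: symD)

lemma card_eq_1_singleton: "card A = 1 \<Longrightarrow> \<exists>a. A = {a}"
  by (auto simp: card_1_singleton_iff)

lemma kite_new_edge:
  assumes "k \<le> n" "k \<le> m" "1 \<le> m"
  shows "books_at 0 0 0 {..<Suc m} (parcs (kite_graph n k)) m \<subseteq> {book m (m - 1) {} {} {}}"
proof
  fix H assume "H \<in> books_at 0 0 0 {..<Suc m} (parcs (kite_graph n k)) m"
  then obtain u v C P Q where H: "H = book u v C P Q"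
    and b: "is_book 0 0 0 {..<Suc m} (parcs (kite_graph n k)) u v C P Q"
    and m: "m \<in> {u, v} \<union> C \<union> P \<union> Q"
    by (rule books_atE)
  note bd = is_book_0D[OF b sym_kite]
  have [simp]: "C = {}" "P = {}" "Q = {}" using bd by auto
  have "u = m \<and> v = m - 1 \<or> v = m \<and> u = m - 1"
    using m bd(2,3,16) assms by (auto simp: kite_arc_iff)
  then show "H \<in> {book m (m - 1) {} {} {}}"
    using H book_swap[of m "m - 1" "{}" "{}" "{}"] by auto
qed

text \<open>Among the vertices up to \<open>m\<close>, the last one is a leaf and so an end of the
  copy; \<open>k < m\<close> puts \<open>m - 1\<close> on the attached path, where
  \<open>m - 2\<close> is its only other neighbour.\<close>

lemma kite_new_P3:
  assumes "k \<le> n" "k < m" "2 \<le> m"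
  shows "books_at 0 0 1 {..<Suc m} (parcs (kite_graph n k)) m \<subseteq> {book m (m - 1) {} {} {m - 2}}"
proof
  fix H assume "H \<in> books_at 0 0 1 {..<Suc m} (parcs (kite_graph n k)) m"
  then obtain u v C P Q where H: "H = book u v C P Q"
    and b: "is_book 0 0 1 {..<Suc m} (parcs (kite_graph n k)) u v C P Q"
    and m: "m \<in> {u, v} \<union> C \<union> P \<union> Q"
    by (rule books_atE)
  note bd = is_book_0D[OF b sym_kite]
  obtain w where [simp]: "Q = {w}" using card_eq_1_singleton bd(15) by blast
  have [simp]: "C = {}" "P = {}" using bd by auto
  have ne: "u \<noteq> w" "u \<noteq> v" "v \<noteq> w" and vw: "(v, w) \<in> parcs (kite_graph n k)"
    and lt: "u < Suc m" "v < Suc m" "w < Suc m"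
    using bd by auto
  have "v = m - 1 \<and> (u = m \<and> w = m - 2 \<or> w = m \<and> u = m - 2)"
    using m bd(16) ne vw lt assms by (auto simp: kite_arc_iff)
  \<comment> \<open>Either end of the three-vertex path may play the role of \<open>u\<close>; both
    readings give the same subgraph.\<close>
  moreover have "book (m - 2) (m - 1) {} {} {m} = book m (m - 1) {} {} {m - 2}"
    by (rule pair_pre_digraph.equality) (auto simp: book_def)
  ultimately show "H \<in> {book m (m - 1) {} {} {m - 2}}" using H by auto
qed

text \<open>Vertex \<open>k + 1\<close> is a leaf at \<open>k\<close>, whose only other neighbour is
  \<open>k - 1\<close>. If this leaf is in \<open>P\<close>, the base edge joins \<open>k\<close> to
  \<open>k - 1\<close> and \<open>Q\<close> lies among the other clique vertices. If it is in
  \<open>Q\<close>, then \<open>v = k\<close> has degree two, so \<open>q = 1\<close> and the same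
  path is read from its other end.\<close>

lemma kite_new_double_star_first:
  assumes "Suc k < n" "2 \<le> k" "1 \<le> q"
  shows "books_at 0 1 q {..<Suc (Suc k)} (parcs (kite_graph n k)) (Suc k) \<subseteq>
    (\<lambda>S. book k (k - 1) {} {Suc k} S) ` {S. S \<subseteq> {..<k - 1} \<and> card S = q}"
proof
  fix H assume "H \<in> books_at 0 1 q {..<Suc (Suc k)} (parcs (kite_graph n k)) (Suc k)"
  then obtain u v C P Q where H: "H = book u v C P Q"
    and b: "is_book 0 1 q {..<Suc (Suc k)} (parcs (kite_graph n k)) u v C P Q"
    and m: "Suc k \<in> {u, v} \<union> C \<union> P \<union> Q"
    by (rule books_atE)
  note bd = is_book_0D[OF b sym_kite]
  have kn: "k \<le> n" using assms(1) by simp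
  obtain a where [simp]: "P = {a}" using card_eq_1_singleton bd(14) by blast
  have [simp]: "C = {}" by (rule bd(1))
  have ne: "a \<noteq> u" "a \<noteq> v" "u \<noteq> v" "\<And>w. w \<in> Q \<Longrightarrow> w \<noteq> a" "\<And>w. w \<in> Q \<Longrightarrow> w \<noteq> u" "\<And>w. w \<in> Q \<Longrightarrow> w \<noteq> v"
    and ua: "(u, a) \<in> parcs (kite_graph n k)"
    and lt: "u < Suc (Suc k)" "v < Suc (Suc k)" "a < Suc (Suc k)" "\<And>w. w \<in> Q \<Longrightarrow> w < Suc (Suc k)"
    using bd by auto
  \<comment> \<open>The end \<open>u\<close> has the two neighbours \<open>v\<close> and
    \<open>a\<close>, the last vertex only one.\<close>
  have u: "u \<noteq> Suc k" using ua bd(16) ne(2) lt assms by (auto simp: kite_arc_iff)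
  show "H \<in> (\<lambda>S. book k (k - 1) {} {Suc k} S) ` {S. S \<subseteq> {..<k - 1} \<and> card S = q}"
  proof (cases "a = Suc k")
    case True
    have uk: "u = k" using ua lt u assms(1,2) unfolding True by (auto simp: kite_arc_iff)
    have vk: "v = k - 1" using bd(16) ne(2) lt u assms(1,2) unfolding True uk
      by (auto simp: kite_arc_iff)
    have "Q \<subseteq> {..<k - 1}"
    proof
      fix w assume w: "w \<in> Q"
      show "w \<in> {..<k - 1}"
        using bd(19)[OF w] ne(5)[OF w] ne(6)[OF w] assms(1,2) unfolding uk vk
        by (auto simp: kite_arc_iff)
    qed
    then show ?thesis using H bd(15) True uk vk by auto
  next
    case False
    \<comment> \<open>With two or more leaves \<open>v\<close> would have degree at least three and
      lie in the clique, out of reach of \<open>k + 1\<close>.\<close>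
    have q1: "q = 1"
    proof (rule ccontr)
      assume "q \<noteq> 1"
      have "card (insert u Q) = Suc q" using bd by auto
      moreover have "k \<le> v \<Longrightarrow> card (insert u Q) \<le> 2"
        using bd(17,19) by (auto intro!: kite_degree_le_2[OF kn])
      ultimately have "v < k" using assms(3) \<open>q \<noteq> 1\<close> by fastforce
      then show False using m False u bd(19)[of "Suc k"] assms(1) by (auto simp: kite_arc_iff)
    qed
    then obtain w where [simp]: "Q = {w}" using card_eq_1_singleton bd(15) by blast
    have vw: "(v, w) \<in> parcs (kite_graph n k)" and w: "w < Suc (Suc k)" "w \<noteq> u" "w \<noteq> v"
      using bd(19) lt(4) ne by auto
    have "v \<noteq> Suc k" using bd(16) vw w ne lt assms(1) by (auto simp: kite_arc_iff)
    then have wk: "w = Suc k" using m False u by simp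
    have vk: "v = k" using vw lt \<open>v \<noteq> Suc k\<close> assms(1,2) unfolding wk by (auto simp: kite_arc_iff)
    have uk: "u = k - 1" using bd(16) w(2) lt u assms(1,2) unfolding vk wk
      by (auto simp: kite_arc_iff)
    have "a < k - 1" using ua ne assms(1,2) unfolding uk vk by (auto simp: kite_arc_iff)
    moreover have "H = book k (k - 1) {} {Suc k} {a}"
      unfolding H uk vk using book_swap[of "k - 1" k "{}" "{a}" "{Suc k}"] by (simp add: wk)
    ultimately show ?thesis using q1 by auto
  qed
qed

text \<open>The copy ends at the leaf \<open>m\<close> and, as \<open>m - 1\<close> and
  \<open>m - 2\<close> both belong to the attached path, has to follow the numbering down to
  \<open>m - 3\<close>.\<close>

lemma kite_new_P4:
  assumes "k \<le> n" "Suc k < m" "2 \<le> k"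
  shows "books_at 0 1 1 {..<Suc m} (parcs (kite_graph n k)) m \<subseteq>
    {book (m - 1) (m - 2) {} {m} {m - 3}}"
proof
  fix H assume "H \<in> books_at 0 1 1 {..<Suc m} (parcs (kite_graph n k)) m"
  then obtain u v C P Q where H: "H = book u v C P Q"
    and b: "is_book 0 1 1 {..<Suc m} (parcs (kite_graph n k)) u v C P Q"
    and m: "m \<in> {u, v} \<union> C \<union> P \<union> Q"
    by (rule books_atE)
  note bd = is_book_0D[OF b sym_kite]
  obtain a where [simp]: "P = {a}" using card_eq_1_singleton bd(14) by blast
  obtain w where [simp]: "Q = {w}" using card_eq_1_singleton bd(15) by blast
  have [simp]: "C = {}" by (rule bd(1))
  have ne: "a \<noteq> u" "a \<noteq> v" "u \<noteq> v" "w \<noteq> a" "w \<noteq> u" "w \<noteq> v"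
    and ua: "(u, a) \<in> parcs (kite_graph n k)" and vw: "(v, w) \<in> parcs (kite_graph n k)"
    and lt: "u < Suc m" "v < Suc m" "a < Suc m" "w < Suc m"
    using bd by auto
  have step: "y = m - 1" if "(m, y) \<in> parcs (kite_graph n k)" "y < Suc m" for y
    using that assms by (auto simp: kite_arc_iff)
  have step2: "y = m - 2" if "(m - 1, y) \<in> parcs (kite_graph n k)" "y < Suc m" "y \<noteq> m" for y
    using that assms by (auto simp: kite_arc_iff)
  have step3: "y = m - 3" if "(m - 2, y) \<in> parcs (kite_graph n k)" "y < Suc m" "y \<noteq> m - 1" for y
    using that assms by (auto simp: kite_arc_iff)
  have sw: "(x, y) \<in> parcs (kite_graph n k) \<Longrightarrow> (y, x) \<in> parcs (kite_graph n k)" for x y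
    using sym_kite[of n k] by (rule symD)
  \<comment> \<open>The ends \<open>u\<close> and \<open>v\<close> have degree two in the copy, so
    the leaf \<open>m\<close> is neither; the last two cases read the path in opposite
    directions.\<close>
  consider "m = u" | "m = v" | "m = a" | "m = w" using m by auto
  then show "H \<in> {book (m - 1) (m - 2) {} {m} {m - 3}}"
  proof cases
    case 1
    have "a = m - 1" by (rule step) (use ua lt(3) 1 in simp_all)
    moreover have "v = m - 1" by (rule step) (use bd(16) lt(2) 1 in simp_all)
    ultimately show ?thesis using ne(2) by simp
  next
    case 2
    have "w = m - 1" by (rule step) (use vw lt(4) 2 in simp_all)
    moreover have "u = m - 1" by (rule step) (use bd(17) lt(1) 2 in simp_all)
    ultimately show ?thesis using ne(5) by simp
  next
    case 3
    have u: "u = m - 1" by (rule step) (use sw[OF ua] lt(1) 3 in simp_all)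
    have v: "v = m - 2" by (rule step2) (use bd(16) lt(2) ne(2) 3 u in simp_all)
    have "w = m - 3" by (rule step3) (use vw lt(4) ne(5) v u in simp_all)
    then show ?thesis unfolding H using 3 u v by simp
  next
    case 4
    have v: "v = m - 1" by (rule step) (use sw[OF vw] lt(2) 4 in simp_all)
    have u: "u = m - 2" by (rule step2) (use bd(17) lt(1) ne(5) 4 v in simp_all)
    have "a = m - 3" by (rule step3) (use ua lt(3) ne(2) v u in simp_all)
    then have "H = book (m - 2) (m - 1) {} {m - 3} {m}" unfolding H using 4 u v by simp
    then show ?thesis by (simp only: book_swap[of "m - 2" "m - 1" "{}" "{m - 3}" "{m}"] singleton_iff)
  qed
qed

text \<open>Having at least three neighbours, \<open>v\<close> lies in the clique. All vertices of
  the copy are within distance two of \<open>v\<close>, whereas \<open>m\<close> is farther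
  away.\<close>

lemma kite_new_double_star:
  assumes "k \<le> n" "Suc k < m" "2 \<le> q"
  shows "books_at 0 1 q {..<Suc m} (parcs (kite_graph n k)) m = {}"
proof (rule equals0I)
  fix H assume "H \<in> books_at 0 1 q {..<Suc m} (parcs (kite_graph n k)) m"
  then obtain u v C P Q where
    b: "is_book 0 1 q {..<Suc m} (parcs (kite_graph n k)) u v C P Q"
    and m: "m \<in> {u, v} \<union> C \<union> P \<union> Q"
    by (rule books_atE)
  note bd = is_book_0D[OF b sym_kite]
  have "card (insert u Q) = Suc q" using bd by auto
  moreover have "k \<le> v \<Longrightarrow> card (insert u Q) \<le> 2"
    using bd(17,19) by (auto intro!: kite_degree_le_2[OF assms(1)])
  ultimately have "v < k" using assms(3) by fastforce
  then show False
    using m bd(1,16) bd(18)[of m] bd(19)[of m] bd(2,3) assms(1,2) by (auto simp: kite_arc_iff)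
qed

section \<open>Growing a graph from a clique\<close>

text \<open>The data of a connected graph that the comparison uses: \<open>boundary\<close> stands
  for connectedness, and \<open>K\<close> is the clique from which the graph is grown.\<close>

locale graph_with_clique =
  fixes V :: "'a set" and E :: "'a rel" and K :: "'a set" and n k :: nat
  assumes finite_V: "finite V" and card_V: "card V = n" and sym_E: "sym E"
    and K_subset: "K \<subseteq> V" and card_K: "card K = k" and k_ge_2: "2 \<le> k"
    and clique: "\<And>a b. a \<in> K \<Longrightarrow> b \<in> K \<Longrightarrow> a \<noteq> b \<Longrightarrow> (a, b) \<in> E"
    and boundary: "\<And>W. W \<subset> V \<Longrightarrow> W \<noteq> {} \<Longrightarrow> \<exists>z\<in>W. \<exists>y\<in>V - W. (z, y) \<in> E"
begin

lemma finite_K: "finite K"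
  using K_subset finite_V by (rule finite_subset)

lemma K_nonempty: "K \<noteq> {}"
  using card_K k_ge_2 by auto

lemma k_le_n: "k \<le> n"
  using card_mono[OF finite_V K_subset] card_K card_V by simp

lemma E_sym: "(a, b) \<in> E \<Longrightarrow> (b, a) \<in> E"
  using sym_E by (rule symD)

text \<open>For \<open>k \<le> m\<close> and \<open>m \<le> n\<close> these arcs induce on
  \<open>{..<m}\<close> the smaller kite on \<open>m\<close> vertices, so the kite grows along
  initial segments.\<close>

abbreviation kite :: "nat rel" where
  "kite \<equiv> parcs (kite_graph n k)"

text \<open>Both graphs gain one vertex at a time, with at most \<open>d\<close> new copies in the
  kite and at least \<open>d\<close> in the graph. \<open>Inv\<close> is the local structure that
  guarantees these copies wherever the next vertex is attached.\<close>

lemma kite_le_if_growing: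
  assumes m0: "1 \<le> m0" "m0 \<le> n"
    and W0: "W0 \<subseteq> V" "card W0 = m0" "Inv W0"
      "card (books t p q {..<m0} kite) \<le> card (books t p q W0 E)"
    and grow: "\<And>W y z. W \<subseteq> V \<Longrightarrow> Inv W \<Longrightarrow> z \<in> W \<Longrightarrow> y \<in> V - W \<Longrightarrow> (z, y) \<in> E \<Longrightarrow>
      Inv (insert y W) \<and> d \<le> card (books_at t p q (insert y W) E y)"
    and kite_new: "\<And>m. m0 \<le> m \<Longrightarrow> m < n \<Longrightarrow> card (books_at t p q {..<Suc m} kite m) \<le> d"
  shows "card (books t p q {..<n} kite) \<le> card (books t p q V E)"
proof -
  have "m \<le> n \<Longrightarrow> \<exists>W\<subseteq>V. card W = m \<and> Inv W \<and>
      card (books t p q {..<m} kite) \<le> card (books t p q W E)" if "m0 \<le> m" for m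
    using that
  proof (induction m rule: dec_induct)
    case base
    show ?case using W0 by blast
  next
    case (step m)
    then obtain W where W: "W \<subseteq> V" "card W = m" "Inv W"
        "card (books t p q {..<m} kite) \<le> card (books t p q W E)"
      by auto
    have "W \<noteq> V" using W(2) card_V step.prems by auto
    moreover have "W \<noteq> {}" using W(2) step.hyps m0 by auto
    ultimately obtain z y where zy: "z \<in> W" "y \<in> V - W" "(z, y) \<in> E"
      using boundary[of W] W(1) by blast
    have finW: "finite W" using W(1) finite_V by (rule finite_subset)
    have new: "Inv (insert y W)" "d \<le> card (books_at t p q (insert y W) E y)"
      using grow[OF W(1,3) zy] by auto
    have "card (books t p q {..<Suc m} kite) =
        card (books t p q {..<m} kite) + card (books_at t p q {..<Suc m} kite m)"
      using card_books_insert[of "{..<m}" m] by (simp add: lessThan_Suc)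
    also have "\<dots> \<le> card (books t p q W E) + card (books_at t p q (insert y W) E y)"
      using W(4) kite_new[of m] new(2) step.hyps step.prems by (intro add_mono) auto
    also have "\<dots> = card (books t p q (insert y W) E)"
      using card_books_insert[OF finW] zy(2) by simp
    finally show ?case
      using W(1,2) zy(2) finW new(1) by (intro exI[of _ "insert y W"]) auto
  qed
  from this[of n] obtain W where W: "W \<subseteq> V" "card W = n"
      "card (books t p q {..<n} kite) \<le> card (books t p q W E)"
    using m0(2) by auto
  have "W = V" using card_subset_eq[OF finite_V W(1)] W(2) card_V by simp
  then show ?thesis using W(3) by simp
qed

section \<open>Embedding the first two kites\<close>

lemma kite_clique_le: "card (books t p q {..<k} kite) \<le> card (books t p q K E)"
proof -
  obtain f where f: "bij_betw f {..<k} K"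
    using ex_bij_betw_nat_finite[OF finite_K] card_K by (auto simp: lessThan_atLeast0)
  show ?thesis
  proof (rule card_books_le_inj[OF finite_K, of f])
    show "inj_on f {..<k}" "f ` {..<k} \<subseteq> K" using f by (auto simp: bij_betw_def)
    show "(f a, f b) \<in> E" if "a \<in> {..<k}" "b \<in> {..<k}" "a \<noteq> b" for a b
      using that f by (intro clique) (auto simp: bij_betw_def inj_on_eq_iff)
  qed
qed

text \<open>\<open>insert x K\<close> contains the kite on \<open>k + 1\<close> vertices; further
  edges from \<open>x\<close> to \<open>K\<close> can only add copies.\<close>

lemma kite_pendant_le:
  assumes "c \<in> K" "x \<in> V - K" "(c, x) \<in> E"
  shows "card (books t p q {..<Suc k} kite) \<le> card (books t p q (insert x K) E)"
proof -
  have "card (K - {c}) = k - 1" using assms(1) card_K finite_K by simp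
  then obtain g where g: "bij_betw g {..<k - 1} (K - {c})"
    using ex_bij_betw_nat_finite[of "K - {c}"] finite_K by (auto simp: lessThan_atLeast0)
  \<comment> \<open>The attaching vertex \<open>k - 1\<close> goes to \<open>c\<close>, the vertex
    \<open>k\<close> to \<open>x\<close>, and the remaining clique vertices to the rest of
    \<open>K\<close>.\<close>
  define f where "f i = (if i < k - 1 then g i else if i = k - 1 then c else x)" for i
  have gK: "g i \<in> K" "g i \<noteq> c" "g i \<noteq> x" if "i < k - 1" for i
    using g that assms(2) unfolding bij_betw_def by auto
  have g_eq: "g i = g j \<longleftrightarrow> i = j" if "i < k - 1" "j < k - 1" for i j
    using g that unfolding bij_betw_def by (auto simp: inj_on_eq_iff)
  have cx: "c \<noteq> x" using assms by blast
  have kn: "Suc k \<le> n"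
    using card_mono[OF finite_V, of "insert x K"] K_subset assms(2) finite_K card_K card_V by auto
  show ?thesis
  proof (rule card_books_le_inj[of _ f])
    show "finite (insert x K)" using finite_K by simp
    show "inj_on f {..<Suc k}"
    proof (rule inj_onI)
      fix i j assume "i \<in> {..<Suc k}" "j \<in> {..<Suc k}" "f i = f j"
      then show "i = j"
        using gK[of i] gK[of j] g_eq[of i j] cx unfolding f_def by (auto split: if_splits)
    qed
    show "f ` {..<Suc k} \<subseteq> insert x K" using gK assms(1) by (auto simp: f_def)
    show "(f a, f b) \<in> E"
      if ab: "a \<in> {..<Suc k}" "b \<in> {..<Suc k}" "a \<noteq> b" "(a, b) \<in> kite" for a b
    proof -
      have "a < k \<and> b < k \<or> a = k - 1 \<and> b = k \<or> a = k \<and> b = k - 1"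
        using ab k_le_n by (auto simp: kite_arc_iff)
      then show ?thesis
      proof (elim disjE)
        assume "a < k \<and> b < k"
        then have "f a \<in> K" "f b \<in> K" "f a \<noteq> f b"
          using ab(3) gK assms(1) g_eq[of a b] by (auto simp: f_def)
        then show ?thesis by (rule clique)
      next
        assume "a = k - 1 \<and> b = k"
        then show ?thesis using k_ge_2 assms(3) by (auto simp: f_def)
      next
        assume "a = k \<and> b = k - 1"
        then show ?thesis using k_ge_2 E_sym[OF assms(3)] by (auto simp: f_def)
      qed
    qed
  qed
qed

text \<open>If \<open>z \<noteq> c\<close>, take the base edge \<open>zc\<close> with leaf
  \<open>y\<close> at \<open>z\<close>, and choose \<open>q\<close> leaves of \<open>c\<close> among
  the other \<open>k - 1\<close> vertices of \<open>insert x K\<close>, all adjacent to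
  \<open>c\<close>. If \<open>z = c\<close>, two disjoint families of sizes
  \<open>(k - 2) choose q\<close> and \<open>(k - 2) choose (q - 1)\<close> add up by Pascal's
  rule.\<close>

lemma double_stars_lower_bound:
  assumes c: "c \<in> K" "x \<in> V - K" "(c, x) \<in> E"
    and y: "z \<in> insert x K" "y \<in> V - insert x K" "(z, y) \<in> E"
    and "1 \<le> q" "3 \<le> k \<or> 2 \<le> q"
  shows "(k - 1) choose q \<le> card (books_at 0 1 q (insert y (insert x K)) E y)"
proof -
  let ?W = "insert y (insert x K)"
  let ?B = "books_at 0 1 q ?W E y"
  have fin: "finite ?B" "finite (insert x K)" using finite_K by (auto intro: finite_books_at)
  have cK: "(c, w) \<in> E" if "w \<in> insert x K" "w \<noteq> c" for w
    using that clique[OF c(1)] c(3) by auto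
  have neq: "c \<noteq> x" "y \<noteq> x" "y \<notin> K" "y \<noteq> z" "y \<noteq> c" using c y by auto
  have card_xK: "card (insert x K) = Suc k" using c(2) finite_K card_K by simp
  show ?thesis
  proof (cases "z = c")
    case False
    let ?A = "insert x K - {z, c}"
    let ?f = "\<lambda>S. book z c {} {y} S"
    have "card ?A = k - 1" using False c(1) y(1) card_xK fin(2) by (simp add: card_Diff_subset)
    then have "(k - 1) choose q = card {S. S \<subseteq> ?A \<and> card S = q}"
      using fin(2) n_subsets[of ?A q] by simp
    also have "\<dots> \<le> card ?B"
    proof (rule card_inj_on_le[OF _ _ fin(1)])
      show "inj_on ?f {S. S \<subseteq> ?A \<and> card S = q}"
      proof (rule inj_onI)
        fix S S' assume S: "S \<in> {S. S \<subseteq> ?A \<and> card S = q}" "S' \<in> {S. S \<subseteq> ?A \<and> card S = q}"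
          "?f S = ?f S'"
        \<comment> \<open>\<open>S\<close> avoids the three fixed vertices, so the vertex set of the
          book determines it.\<close>
        have "S = pverts (?f S) - {z, c, y}" if "S \<subseteq> ?A" for S
          using that y(2) by auto
        then show "S = S'" using S by (metis mem_Collect_eq)
      qed
      show "?f ` {S. S \<subseteq> ?A \<and> card S = q} \<subseteq> ?B"
      proof (rule image_subsetI)
        fix S assume "S \<in> {S. S \<subseteq> ?A \<and> card S = q}"
        then have S: "S \<subseteq> ?A" "card S = q" by auto
        have "finite S" using S(1) fin(2) finite_subset by blast
        moreover have "(z, c) \<in> E" using cK[of z] y(1) False E_sym by blast
        moreover have "{c} \<times> S \<subseteq> E" using S(1) cK by blast
        ultimately have "is_book 0 1 q ?W E z c {} {y} S"
          using S y c neq False unfolding is_book_def by auto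
        then show "?f S \<in> ?B" by (rule books_atI) simp
      qed
    qed
    finally show ?thesis .
  next
    case True
    show ?thesis
    proof (cases "3 \<le> k")
      case False
      \<comment> \<open>Here \<open>k = 2\<close> and \<open>q \<ge> 2\<close>, so the binomial
        coefficient vanishes.\<close>
      then show ?thesis using assms(8) by (simp add: binomial_eq_0)
    next
      case k3: True
      have "2 \<le> card (K - {c})" using k3 c(1) card_K finite_K by simp
      then obtain w w' where w: "w \<in> K - {c}" "w' \<in> K - {c}" "w \<noteq> w'"
        using finite_K by (metis card_le_Suc0_iff_eq finite_Diff not_less_eq_eq numeral_2_eq_2)
      \<comment> \<open>In the first family \<open>y\<close> is the leaf at \<open>c\<close>, and
        the \<open>q\<close> leaves of \<open>w\<close> come from the rest of \<open>K\<close>. In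
        the second \<open>w\<close> is the leaf at \<open>w'\<close>, and \<open>y\<close> is one of
        the \<open>q\<close> leaves of \<open>c\<close>. Both candidate sets have
        \<open>k - 2\<close> elements.\<close>
      let ?A1 = "K - {c, w}" and ?A2 = "insert x K - {c, w, w'}"
      let ?f1 = "\<lambda>S. book c w {} {y} S" and ?f2 = "\<lambda>S. book w' c {} {w} (insert y S)"
      let ?S1 = "{S. S \<subseteq> ?A1 \<and> card S = q}" and ?S2 = "{S. S \<subseteq> ?A2 \<and> card S = q - 1}"
      have cy: "(c, y) \<in> E" using y(3) True by simp
      have "card ?A1 = k - 2" using w c(1) finite_K card_K by (subst card_Diff_subset) auto
      then have S1: "card ?S1 = (k - 2) choose q" using finite_K n_subsets[of ?A1 q] by simp
      have "card ?A2 = k - 2" using w c(1) fin(2) card_xK by (subst card_Diff_subset) auto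
      then have S2: "card ?S2 = (k - 2) choose (q - 1)"
        using fin(2) n_subsets[of ?A2 "q - 1"] by simp
      have inj1: "inj_on ?f1 ?S1"
      proof (rule inj_onI)
        fix S S' assume S: "S \<in> ?S1" "S' \<in> ?S1" "?f1 S = ?f1 S'"
        have "S = pverts (?f1 S) - {c, w, y}" if "S \<subseteq> ?A1" for S
          using that y(2) by auto
        then show "S = S'" using S by (metis mem_Collect_eq)
      qed
      have inj2: "inj_on ?f2 ?S2"
      proof (rule inj_onI)
        fix S S' assume S: "S \<in> ?S2" "S' \<in> ?S2" "?f2 S = ?f2 S'"
        have "S = pverts (?f2 S) - {c, w, w', y}" if "S \<subseteq> ?A2" for S
          using that y(2) by auto
        then show "S = S'" using S by (metis mem_Collect_eq)
      qed
      have sub1: "?f1 ` ?S1 \<subseteq> ?B"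
      proof (rule image_subsetI)
        fix S assume "S \<in> ?S1"
        then have S: "S \<subseteq> ?A1" "card S = q" by auto
        have "finite S" using S(1) finite_K finite_subset by blast
        moreover have "(c, w) \<in> E" using clique c(1) w(1) by auto
        moreover have "{w} \<times> S \<subseteq> E" using S(1) clique w(1) by auto
        ultimately have "is_book 0 1 q ?W E c w {} {y} S"
          using S cy c neq w unfolding is_book_def by auto
        then show "?f1 S \<in> ?B" by (rule books_atI) simp
      qed
      have sub2: "?f2 ` ?S2 \<subseteq> ?B"
      proof (rule image_subsetI)
        fix S assume "S \<in> ?S2"
        then have S: "S \<subseteq> ?A2" "card S = q - 1" by auto
        have "finite S" using S(1) fin(2) finite_subset by blast
        moreover have "y \<notin> S" using S(1) y(2) by blast
        ultimately have "finite (insert y S)" "card (insert y S) = q" using S(2) assms(7) by auto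
        moreover have "(w', c) \<in> E" "(w', w) \<in> E" using clique c(1) w by auto
        moreover have "{c} \<times> insert y S \<subseteq> E" using S(1) cK cy by blast
        ultimately have "is_book 0 1 q ?W E w' c {} {w} (insert y S)"
          using S c neq w y(2) unfolding is_book_def by auto
        then show "?f2 S \<in> ?B" by (rule books_atI) simp
      qed
      text \<open>The two families differ in whether the edge \<open>cw\<close> is used.\<close>
      have disj: "?f1 ` ?S1 \<inter> ?f2 ` ?S2 = {}"
      proof -
        have "(c, w) \<in> parcs (?f1 S)" for S by (simp add: book_def)
        moreover have "(c, w) \<notin> parcs (?f2 S)" if "S \<subseteq> ?A2" for S
          using that w neq by (auto simp: book_def)
        ultimately show ?thesis by (auto 0 3 simp: set_eq_iff image_iff) metis
      qed
      have "(k - 1) choose q = card ?S1 + card ?S2"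
        using S1 S2 choose_reduce_nat[of "k - 1" q] k3 assms(7)
        by (simp add: numeral_2_eq_2 add.commute)
      also have "\<dots> = card (?f1 ` ?S1) + card (?f2 ` ?S2)"
        by (simp only: card_image[OF inj1] card_image[OF inj2])
      also have "\<dots> = card (?f1 ` ?S1 \<union> ?f2 ` ?S2)"
        using disj sub1 sub2 fin(1) by (intro card_Un_disjoint[symmetric]) (auto intro: finite_subset)
      also have "\<dots> \<le> card ?B" using sub1 sub2 by (intro card_mono fin(1)) auto
      finally show ?thesis .
    qed
  qed
qed

end

section \<open>Comparison of the kite with an arbitrary connected graph\<close>

lemma one_le_card_books_at:
  assumes "is_book t p q V E u v C P Q" "x \<in> {u, v} \<union> C \<union> P \<union> Q" "finite V"
  shows "1 \<le> card (books_at t p q V E x)"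
  using books_atI[OF assms(1,2)] finite_books_at[OF assms(3)]
  by (metis One_nat_def Suc_leI card_gt_0_iff empty_iff)

lemma card_le_1_if_subset_singleton: "A \<subseteq> {a} \<Longrightarrow> card A \<le> 1"
  using card_mono[of "{a}" A] by simp

context graph_with_clique
begin

text \<open>The cases differ in how far along its path the kite still gains copies; this decides
  where the growth starts and which \<open>d\<close> is used.\<close>

lemma kite_le_ordered:
  assumes exc: "\<not> (k = 2 \<and> t = 0 \<and> p = 1 \<and> q = 1)" and "p \<le> q"
  shows "card (books t p q {..<n} kite) \<le> card (books t p q V E)"
proof (cases "n = k")
  case True
  then have "K = V" using card_subset_eq[OF finite_V K_subset] card_K card_V by simp
  then show ?thesis using kite_clique_le True by simp
next
  case False
  then have kn: "Suc k \<le> n" using k_le_n by simp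
  have "K \<noteq> V" using False card_K card_V by auto
  then obtain c x where c: "c \<in> K" and x: "x \<in> V - K" "(c, x) \<in> E"
    using boundary[of K] K_subset K_nonempty by blast
  have cx: "c \<noteq> x" and xc: "(x, c) \<in> E" using c x E_sym by auto
  have xK: "insert x K \<subseteq> V" "card (insert x K) = Suc k"
    using x K_subset finite_K card_K by auto
  note pendant = kite_pendant_le[OF c x]
  have other: "\<exists>b\<in>K. a \<noteq> b" if "a \<in> K" for a
  proof -
    have "card (K - {a}) \<noteq> 0" using that card_K finite_K k_ge_2 by simp
    then obtain b where "b \<in> K - {a}" by (metis card.empty ex_in_conv)
    then have "b \<in> K" "b \<noteq> a" by simp_all
    then show ?thesis by metis
  qed
  have finite_insert: "finite (insert y W)" if "W \<subseteq> V" for W y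
    using that finite_V finite_subset by auto
  consider (local) "1 \<le> t \<or> 2 \<le> p \<and> 2 \<le> q \<or> p = 0 \<and> 2 \<le> q"
    | (edge) "t = 0" "p = 0" "q = 0" | (P3) "t = 0" "p = 0" "q = 1"
    | (double_star) "t = 0" "p = 1" "1 \<le> q"
    using \<open>p \<le> q\<close> by linarith
  then show ?thesis
  proof cases
    case local
    show ?thesis
    \<comment> \<open>No vertex of the kite beyond \<open>k\<close> lies in a copy, so
      \<open>d = 0\<close> and a trivial invariant suffice.\<close>
    proof (rule kite_le_if_growing[where Inv = "\<lambda>_. True" and d = 0, OF _ kn xK _ pendant])
      show "card (books_at t p q {..<Suc m} kite m) \<le> 0" if "Suc k \<le> m" for m
        using kite_new_local[OF k_le_n _ local, of m] that by simp
    qed auto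
  next
    case edge
    show ?thesis unfolding edge
    \<comment> \<open>Growth starts at the clique itself, since already the first vertex of the
      attached path brings only one new edge.\<close>
    proof (rule kite_le_if_growing[where Inv = "\<lambda>_. True" and d = 1,
          OF _ k_le_n K_subset card_K _ kite_clique_le])
      show "True \<and> 1 \<le> card (books_at 0 0 0 (insert y W) E y)"
        if "W \<subseteq> V" "z \<in> W" "y \<in> V - W" "(z, y) \<in> E" for W y z
      proof -
        have "is_book 0 0 0 (insert y W) E z y {} {} {}" using that by (auto simp: is_book_def)
        then have "1 \<le> card (books_at 0 0 0 (insert y W) E y)"
          by (rule one_le_card_books_at) (use finite_insert[OF that(1)] in simp_all)
        then show ?thesis by simp
      qed
      show "card (books_at 0 0 0 {..<Suc m} kite m) \<le> 1" if "k \<le> m" for m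
        using kite_new_edge[OF k_le_n that] that k_ge_2
        by (intro card_le_1_if_subset_singleton) auto
    qed (use k_ge_2 in auto)
  next
    case P3
    \<comment> \<open>Every vertex has a neighbour inside the set, so a new vertex \<open>y\<close>
      attached at \<open>z\<close> starts a path \<open>y\<close>, \<open>z\<close>,
      \<open>w\<close>.\<close>
    let ?Inv = "\<lambda>W. \<forall>z\<in>W. \<exists>w\<in>W. z \<noteq> w \<and> (z, w) \<in> E"
    show ?thesis unfolding P3
    proof (rule kite_le_if_growing[where Inv = ?Inv and d = 1, OF _ kn xK _ pendant])
      show "?Inv (insert x K)"
        using other clique c xc cx by (metis insert_iff)
      show "?Inv (insert y W) \<and> 1 \<le> card (books_at 0 0 1 (insert y W) E y)"
        if grow: "W \<subseteq> V" "?Inv W" "z \<in> W" "y \<in> V - W" "(z, y) \<in> E" for W y z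
      proof
        have yz: "y \<noteq> z" "(y, z) \<in> E" using grow E_sym by auto
        then show "?Inv (insert y W)" using grow(2,3) by blast
        obtain w where "w \<in> W" "z \<noteq> w" "(z, w) \<in> E" using grow(2,3) by blast
        then have "is_book 0 0 1 (insert y W) E y z {} {} {w}"
          using grow yz by (auto simp: is_book_def)
        then show "1 \<le> card (books_at 0 0 1 (insert y W) E y)"
          by (rule one_le_card_books_at) (use finite_insert[OF grow(1)] in simp_all)
      qed
      show "card (books_at 0 0 1 {..<Suc m} kite m) \<le> 1" if "Suc k \<le> m" for m
        using kite_new_P3[OF k_le_n, of m] that k_ge_2
        by (intro card_le_1_if_subset_singleton) auto
    qed auto
  next
    case double_star
    show ?thesis
    proof (cases "n = Suc k")
      case True
      then have "insert x K = V" using card_subset_eq[OF finite_V xK(1)] xK(2) card_V by simp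
      then show ?thesis using pendant[of t p q] True by simp
    next
      case False
      then have kn2: "Suc (Suc k) \<le> n" using kn by simp
      \<comment> \<open>The second added vertex is compared separately, against the bound
        \<open>(k - 1) choose q\<close>; growth with a constant \<open>d\<close> begins only after
        it.\<close>
      have "insert x K \<noteq> V" using False xK(2) card_V by auto
      then obtain z y where z: "z \<in> insert x K" and y: "y \<in> V - insert x K" "(z, y) \<in> E"
        using boundary[of "insert x K"] xK(1) by blast
      let ?W = "insert y (insert x K)"
      have W: "?W \<subseteq> V" "card ?W = Suc (Suc k)"
        using xK y finite_K by auto
      \<comment> \<open>The exceptional case is excluded here: with \<open>k = 2\<close> and
        \<open>q = 1\<close> both alternatives fail.\<close>
      have k3: "3 \<le> k \<or> 2 \<le> q" using exc double_star k_ge_2 by linarith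
      have "card (books_at 0 1 q {..<Suc (Suc k)} kite (Suc k)) \<le>
          card ((\<lambda>S. book k (k - 1) {} {Suc k} S) ` {S. S \<subseteq> {..<k - 1} \<and> card S = q})"
        using kite_new_double_star_first[OF _ k_ge_2 double_star(3), of n] kn2
        by (intro card_mono) auto
      also have "\<dots> \<le> card {S. S \<subseteq> {..<k - 1} \<and> card S = q}"
        by (intro card_image_le) auto
      also have "\<dots> = (k - 1) choose q" using n_subsets[of "{..<k - 1}" q] by simp
      also have "\<dots> \<le> card (books_at 0 1 q ?W E y)"
        by (rule double_stars_lower_bound[OF c x z y double_star(3) k3])
      finally have "card (books 0 1 q {..<Suc (Suc k)} kite) \<le> card (books 0 1 q ?W E)"
        using pendant[of 0 1 q] card_books_insert[of "insert x K" y] y(1) finite_K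
          card_books_insert[of "{..<Suc k}" "Suc k"]
        by (simp add: lessThan_Suc[of "Suc k"])
      note base = this
      show ?thesis
      proof (cases "q = 1")
        case False
        then have q2: "2 \<le> q" using double_star(3) by simp
        show ?thesis unfolding double_star(1,2)
        proof (rule kite_le_if_growing[where Inv = "\<lambda>_. True" and d = 0, OF _ kn2 W _ base])
          show "card (books_at 0 1 q {..<Suc m} kite m) \<le> 0" if "Suc (Suc k) \<le> m" for m
            using kite_new_double_star[OF k_le_n _ q2, of m] that by simp
        qed auto
      next
        case True
        then have k3: "3 \<le> k" using exc double_star k_ge_2 by linarith
        \<comment> \<open>Every vertex starts a path on three vertices inside the set, so a vertex
          attached to it completes a four-vertex path. The centre of a star would violate
          this.\<close>
        let ?Inv = "\<lambda>W. \<forall>z\<in>W. \<exists>w\<in>W. \<exists>v\<in>W. z \<noteq> w \<and> z \<noteq> v \<and> w \<noteq> v \<and> (z, w) \<in> E \<and> (w, v) \<in> E"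
        have extend: "?Inv (insert y W)"
          if grow: "?Inv W" "z \<in> W" "y \<notin> W" "(z, y) \<in> E" for W y z
        proof -
          obtain w where "w \<in> W" "z \<noteq> w" "(z, w) \<in> E" using grow by blast
          then have "\<exists>w\<in>insert y W. \<exists>v\<in>insert y W.
              y \<noteq> w \<and> y \<noteq> v \<and> w \<noteq> v \<and> (y, w) \<in> E \<and> (w, v) \<in> E"
            using grow E_sym by (intro bexI[of _ z] bexI[of _ w]) auto
          then show ?thesis using grow(1) by blast
        qed
        have InvK: "?Inv K"
        proof
          fix a assume a: "a \<in> K"
          then have "2 \<le> card (K - {a})" using k3 card_K finite_K by simp
          then obtain w v where "w \<in> K - {a}" "v \<in> K - {a}" "w \<noteq> v"
            using finite_K by (metis card_le_Suc0_iff_eq finite_Diff not_less_eq_eq numeral_2_eq_2)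
          then show "\<exists>w\<in>K. \<exists>v\<in>K. a \<noteq> w \<and> a \<noteq> v \<and> w \<noteq> v \<and> (a, w) \<in> E \<and> (w, v) \<in> E"
            using a clique[of a w] clique[of w v]
            by (intro bexI[of _ w] bexI[of _ v]) (simp_all, metis)
        qed
        show ?thesis unfolding double_star(1,2)
        proof (rule kite_le_if_growing[where Inv = ?Inv and d = 1, OF _ kn2 W _ base])
          have "?Inv (insert x K)" using extend[OF InvK c _ x(2)] x(1) by blast
          then show "?Inv ?W" by (rule extend[OF _ z _ y(2)]) (use y(1) in blast)
          show "?Inv (insert y W) \<and> 1 \<le> card (books_at 0 1 q (insert y W) E y)"
            if grow: "W \<subseteq> V" "?Inv W" "z \<in> W" "y \<in> V - W" "(z, y) \<in> E" for W y z
          proof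
            show "?Inv (insert y W)" by (rule extend[OF grow(2,3) _ grow(5)]) (use grow(4) in blast)
            obtain w v where wv: "w \<in> W" "v \<in> W" "z \<noteq> w" "z \<noteq> v" "w \<noteq> v" "(z, w) \<in> E" "(w, v) \<in> E"
              using grow(2,3) by blast
            have "is_book 0 1 q (insert y W) E z w {} {y} {v}"
              using grow wv True by (auto simp: is_book_def)
            then show "1 \<le> card (books_at 0 1 q (insert y W) E y)"
              by (rule one_le_card_books_at) (use finite_insert[OF grow(1)] in simp_all)
          qed
          show "card (books_at 0 1 q {..<Suc m} kite m) \<le> 1" if "Suc (Suc k) \<le> m" for m
            using kite_new_P4[OF k_le_n _ k_ge_2, of m] that True
            by (intro card_le_1_if_subset_singleton) auto
        qed auto
      qed
    qed
  qed
qed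

lemma kite_le:
  assumes "\<not> (k = 2 \<and> t = 0 \<and> p = 1 \<and> q = 1)"
  shows "card (books t p q {..<n} kite) \<le> card (books t p q V E)"
proof (cases "p \<le> q")
  case True
  then show ?thesis using kite_le_ordered assms by blast
next
  case False
  then have "card (books t q p {..<n} kite) \<le> card (books t q p V E)"
    using assms by (intro kite_le_ordered) auto
  then show ?thesis using books_swap[OF sym_kite] books_swap[OF sym_E] by metis
qed

end

section \<open>The extremal graphs\<close>

lemma pair_graph_kite: "pair_graph (kite_graph n k)" if "k \<le> n"
  unfolding kite_graph_def using that by (intro pair_graph_undirected) auto

text \<open>All vertices are reached from \<open>0\<close> along the numbering. A clique not inside
  \<open>{..<k}\<close> has a greatest vertex \<open>m \<ge> k\<close>, whose only smaller neighbour
  is \<open>m - 1\<close>, so its size is at most \<open>2 \<le> k\<close>.\<close>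

lemma kite_in_connected_graphs:
  assumes "2 \<le> k" "k \<le> n"
  shows "kite_graph n k \<in> connected_graphs n k"
proof -
  interpret pair_graph "kite_graph n k" using assms(2) by (rule pair_graph_kite)
  have reach: "i < n \<Longrightarrow> 0 \<rightarrow>\<^sup>*\<^bsub>with_proj (kite_graph n k)\<^esub> i" for i
  proof (induction i)
    case 0
    then show ?case by (simp add: reachable_refl)
  next
    case (Suc i)
    have "0 \<rightarrow>\<^sup>*\<^bsub>with_proj (kite_graph n k)\<^esub> i" using Suc by simp
    moreover have "(i, Suc i) \<in> parcs (kite_graph n k)"
      using Suc.prems assms(2) by (auto simp: kite_arc_iff)
    ultimately show ?case by (rule reachable_adj_trans)
  qed
  have "Digraph_Component.connected (with_proj (kite_graph n k))"
    by (rule connectedI_root[of 0]) (use reach assms in auto)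
  moreover have "clique_number (kite_graph n k) = k"
  proof (rule clique_number_eqI)
    show "{..<k} \<in> cliques (pverts (kite_graph n k)) (parcs (kite_graph n k))"
      using assms(2) by (auto simp: cliques_def kite_arc_iff)
    fix S assume "S \<in> cliques (pverts (kite_graph n k)) (parcs (kite_graph n k))"
    then have S: "S \<subseteq> {..<n}" "\<And>x y. x \<in> S \<Longrightarrow> y \<in> S \<Longrightarrow> x \<noteq> y \<Longrightarrow> (x, y) \<in> parcs (kite_graph n k)"
      by (auto simp: cliques_def)
    have fin: "finite S" using S(1) finite_subset by blast
    show "card S \<le> k"
    proof (cases "S \<subseteq> {..<k}")
      case True
      then show ?thesis using card_mono[of "{..<k}" S] by simp
    next
      case False
      then have "S \<noteq> {}" by auto
      define m where "m = Max S"
      have m: "m \<in> S" "\<And>i. i \<in> S \<Longrightarrow> i \<le> m"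
        using fin \<open>S \<noteq> {}\<close> by (auto simp: m_def)
      have "k \<le> m" using False m(2) by (meson lessThan_iff not_le order_trans subsetI)
      have "S \<subseteq> {m - 1, m}"
      proof
        fix i assume i: "i \<in> S"
        show "i \<in> {m - 1, m}"
          using S(2)[OF i m(1)] m(2)[OF i] \<open>k \<le> m\<close> assms(2) by (auto simp: kite_arc_iff)
      qed
      then have "card S \<le> card {m - 1, m}" by (intro card_mono) auto
      also have "\<dots> \<le> 2" by (simp add: card_insert_if)
      finally show ?thesis using assms(1) by simp
    qed
  qed simp
  ultimately show ?thesis
    unfolding connected_graphs_def using pair_graph_kite[OF assms(2)] by simp
qed

section \<open>The star and the path on four vertices\<close>

lemma pverts_star [simp]: "pverts (star_graph n) = {..<n}"
  by (simp add: star_graph_def)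

lemma star_arc_iff:
  "(i, j) \<in> parcs (star_graph n) \<longleftrightarrow> i < n \<and> j < n \<and> i \<noteq> j \<and> (i = 0 \<or> j = 0)"
  by (auto simp: star_graph_def)

lemma pair_graph_star: "pair_graph (star_graph n)"
  unfolding star_graph_def by (intro pair_graph_undirected) auto

text \<open>Any two vertices of a clique include the centre \<open>0\<close>, so a clique contains
  at most one leaf besides it.\<close>

lemma star_in_connected_graphs:
  assumes "2 \<le> n"
  shows "star_graph n \<in> connected_graphs n 2"
proof -
  interpret pair_graph "star_graph n" by (rule pair_graph_star)
  have reach: "0 \<rightarrow>\<^sup>*\<^bsub>with_proj (star_graph n)\<^esub> i" if "i < n" for i
  proof (cases "i = 0")
    case True then show ?thesis using that by (auto intro: reachable_refl)
  next
    case False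
    then show ?thesis using that by (intro reachable_adjI) (simp add: star_arc_iff)
  qed
  have "Digraph_Component.connected (with_proj (star_graph n))"
    by (rule connectedI_root[of 0]) (use reach assms in auto)
  moreover have "clique_number (star_graph n) = 2"
  proof (rule clique_number_eqI)
    show "{0, 1} \<in> cliques (pverts (star_graph n)) (parcs (star_graph n))"
      using assms by (auto simp: cliques_def star_arc_iff)
    fix S assume "S \<in> cliques (pverts (star_graph n)) (parcs (star_graph n))"
    then have S: "S \<subseteq> {..<n}" "\<And>x y. x \<in> S \<Longrightarrow> y \<in> S \<Longrightarrow> x \<noteq> y \<Longrightarrow> x = 0 \<or> y = 0"
      by (auto simp: cliques_def star_arc_iff)
    then have "\<exists>a. S \<subseteq> {0, a}" by blast
    then obtain a where "S \<subseteq> {0, a}" ..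
    then have "card S \<le> card {0, a}" by (intro card_mono) auto
    also have "\<dots> \<le> 2" by (simp add: card_insert_if)
    finally show "card S \<le> 2" .
  qed simp
  ultimately show ?thesis
    unfolding connected_graphs_def using pair_graph_star by simp
qed

text \<open>The two pendant edges of a copy share no vertex, whereas all edges of a star meet in the
  centre.\<close>

lemma no_P4_in_star: "books 0 1 1 V (parcs (star_graph n)) = {}"
proof (rule equals0I)
  fix H assume "H \<in> books 0 1 1 V (parcs (star_graph n))"
  then obtain u v C P Q where b: "is_book 0 1 1 V (parcs (star_graph n)) u v C P Q"
    unfolding books_def by blast
  have "sym (parcs (star_graph n))" using pair_graph.sym_parcs pair_graph_star by blast
  note bd = is_book_0D[OF b this]
  obtain a w where "P = {a}" "Q = {w}" using card_eq_1_singleton bd(14,15) by metis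
  then have "(u, v) \<in> parcs (star_graph n)" "(u, a) \<in> parcs (star_graph n)"
      "(v, w) \<in> parcs (star_graph n)" "v \<noteq> a" "u \<noteq> w" "a \<noteq> w"
    using bd by auto
  then show False by (auto simp: star_arc_iff)
qed

lemma book_graph_iso_path4:
  "digraph_iso (with_proj (book_graph 0 1 1)) (with_proj (path_graph 4))"
proof -
  interpret pair_graph "book_graph 0 1 1" by (rule pair_graph_book_graph)
  \<comment> \<open>The leaf at \<open>u\<close>, then \<open>u\<close>, \<open>v\<close> and the
    leaf at \<open>v\<close> become \<open>0\<close>, \<open>1\<close>, \<open>2\<close>,
    \<open>3\<close>. The value at \<open>Common\<close> is a dummy, there being no common
    neighbours for \<open>t = 0\<close>.\<close>
  let ?f = "case_book_vertex (1::nat) 2 (\<lambda>_. 0) (\<lambda>_. 0) (\<lambda>_. 3)"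
  have four: "{..<4::nat} = {0, 1, 2, 3}" by auto
  have path: "{(i, Suc i) | i. Suc i < 4} = {(0, 1), (1, 2), (2, 3)}" by auto
  have "inj_on ?f (pverts (book_graph 0 1 1))"
    by (auto simp: book_graph_def inj_on_def)
  moreover have "pverts (path_graph 4) = ?f ` pverts (book_graph 0 1 1)"
    by (auto simp: book_graph_def path_graph_def four lessThan_Suc image_Un)
  moreover have "parcs (path_graph 4) = map_prod ?f ?f ` parcs (book_graph 0 1 1)"
    by (auto simp: book_graph_def path_graph_def path image_arcs_simps lessThan_Suc)
  ultimately show ?thesis
    unfolding digraph_iso_with_proj_iff using pair_wf_digraph by blast
qed

text \<open>A maximum clique serves as \<open>K\<close>, so that its size is the clique number
  \<open>k\<close>.\<close>

lemma obtain_graph_with_clique: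
  assumes "G \<in> connected_graphs n k" "2 \<le> k"
  obtains K where "graph_with_clique (pverts G) (parcs G) K n k"
proof -
  interpret pair_graph G using assms(1) by (simp add: connected_graphs_def)
  obtain K where K: "K \<in> cliques (pverts G) (parcs G)" "card K = clique_number G"
    by (rule obtain_max_clique)
  have "graph_with_clique (pverts G) (parcs G) K n k"
    using assms K connected_boundary pair_finite_verts sym_parcs
    by unfold_locales (auto simp: connected_graphs_def cliques_def)
  then show ?thesis by (rule that)
qed

theorem theorem1p9:
  fixes n k t p q :: nat
  assumes "k \<ge> 2" and "n \<ge> k"
  shows "if k = 2 \<and> t = 0 \<and> p = 1 \<and> q = 1
         then digraph_iso (with_proj (book_graph t p q)) (with_proj (path_graph 4)) \<and>
              star_graph n \<in> connected_graphs n k \<and>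
              (\<forall>G :: 'a pair_pre_digraph. G \<in> connected_graphs n k \<longrightarrow>
                 num_copies (book_graph t p q) (star_graph n) \<le> num_copies (book_graph t p q) G)
         else kite_graph n k \<in> connected_graphs n k \<and>
              (\<forall>G :: 'a pair_pre_digraph. G \<in> connected_graphs n k \<longrightarrow>
                 num_copies (book_graph t p q) (kite_graph n k) \<le> num_copies (book_graph t p q) G)"
proof (cases "k = 2 \<and> t = 0 \<and> p = 1 \<and> q = 1")
  case True
  \<comment> \<open>A count of zero is trivially least.\<close>
  then have "num_copies (book_graph t p q) (star_graph n) = 0"
    using num_copies_book_graph[OF pair_graph_star] no_P4_in_star by simp
  then show ?thesis
    using True star_in_connected_graphs assms(2) book_graph_iso_path4 by simp
next
  case False
  have "num_copies (book_graph t p q) (kite_graph n k) \<le> num_copies (book_graph t p q) G"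
    if G: "G \<in> connected_graphs n k" for G :: "'a pair_pre_digraph"
  proof -
    obtain K where "graph_with_clique (pverts G) (parcs G) K n k"
      using obtain_graph_with_clique[OF G assms(1)] .
    then interpret graph_with_clique "pverts G" "parcs G" K n k .
    have "pair_graph G" using G by (simp add: connected_graphs_def)
    then show ?thesis
      using kite_le[OF False]
      by (simp only: num_copies_book_graph pair_graph_kite[OF assms(2)] pverts_kite_graph)
  qed
  then show ?thesis using False kite_in_connected_graphs[OF assms] by auto
qed

end
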